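(* Let $N = q^k n^2$ be an odd perfect number, where $q$ is a prime with $q \equiv k \equiv 1 \pmod 4$ and $\gcd(q,n)=1$. Then $$I(n^2) = 2 - \frac{5}{3q}$$ holds if and only if $k=1$ and $q=5$.
   Context: For a positive integer $N$, $\sigma(N)$ denotes the sum of the positive divisors of $N$; $N$ is perfect if $\sigma(N)=2N$. The abundancy index of a positive integer $w$ is $I(w)=\sigma(w)/w$. Euler showed every odd perfect number can be written as $q^k n^2$ with $q$ prime, $q \equiv k \equiv 1 \pmod 4$, and $\gcd(q,n)=1$; such $q$ is called the Euler prime. *)

theory Defs
  imports Complex_Main "HOL-Number_Theory.Number_Theory"
begin

definition divisor_sigma :: "nat \<Rightarrow> nat" where
  "divisor_sigma N = (\<Sum>d | d dvd N. d)"

(* Positivity is explicit: the divisor set of 0 is infinite, so divisor_sigma 0 = 0. *)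
definition perfect :: "nat \<Rightarrow> bool" where
  "perfect N \<longleftrightarrow> N > 0 \<and> divisor_sigma N = 2 * N"

definition abundancy :: "nat \<Rightarrow> real" where
  "abundancy w = real (divisor_sigma w) / real w"

end

theory Submission
  imports Defs
begin

text \<open>
  Multiplicativity of \<open>\<sigma>\<close> turns perfection into \<open>\<sigma>(q\<^sup>k) \<sigma>(n\<^sup>2) = 2 q\<^sup>k n\<^sup>2\<close>. Substituting the
  geometric sum for \<open>\<sigma>(q\<^sup>k)\<close>, the equation \<open>I(n\<^sup>2) = 2 - 5/(3q)\<close> collapses to
  \<open>q\<^sup>k\<^sup>+\<^sup>1 + 5 = 6q\<close>. Hence \<open>q\<close> divides 5, so \<open>q = 5\<close>, and then \<open>k = 1\<close>.
\<close>

text \<open>Multiplication maps pairs of divisors of \<open>a\<close> and \<open>b\<close>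
  bijectively onto the divisors of \<open>a * b\<close>, so the sum over the latter factors as a
  product of two sums.\<close>

lemma divisor_sigma_mult_coprime:
  fixes a b :: nat
  assumes "coprime a b"
  shows "divisor_sigma (a * b) = divisor_sigma a * divisor_sigma b"
proof -
  have inj: "inj_on (\<lambda>(x, y). x * y) ({x. x dvd a} \<times> {y. y dvd b})"
  proof (rule inj_onI, clarify)
    fix x y x' y'
    assume dvds: "x dvd a" "y dvd b" "x' dvd a" "y' dvd b" and eq: "x * y = x' * y'"
    \<comment> \<open>Coprimality across the two sides of \<open>x * y = x' * y'\<close> forces
      \<open>x\<close> and \<open>x'\<close> to divide each other, and likewise \<open>y\<close> and
      \<open>y'\<close>.\<close>
    have "coprime x y'" "coprime x' y"
      using assms dvds by (meson coprime_divisors)+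
    then show "x = x' \<and> y = y'"
      using eq by (simp add: coprime_crossproduct_nat)
  qed
  have img: "(\<lambda>(x, y). x * y) ` ({x. x dvd a} \<times> {y. y dvd b}) = {d. d dvd a * b}"
    by (force simp: mult_dvd_mono dest: division_decomp)
  have "divisor_sigma (a * b) = (\<Sum>(x, y)\<in>{x. x dvd a} \<times> {y. y dvd b}. x * y)"
    unfolding divisor_sigma_def img[symmetric]
    by (subst sum.reindex[OF inj]) (simp add: case_prod_unfold)
  also have "\<dots> = divisor_sigma a * divisor_sigma b"
    by (simp add: divisor_sigma_def sum_product sum.cartesian_product)
  finally show ?thesis .
qed

lemma divisor_sigma_prime_power:
  fixes p k :: nat
  assumes "prime p"
  shows "divisor_sigma (p ^ k) = (\<Sum>i\<le>k. p ^ i)"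
proof -
  have "inj_on (\<lambda>i. p ^ i) {..k}"
    using prime_gt_1_nat[OF assms] by (auto intro: inj_onI)
  moreover have "{d. d dvd p ^ k} = (\<lambda>i. p ^ i) ` {..k}"
    using assms by (auto simp: divides_primepow_nat)
  ultimately show ?thesis
    by (simp add: divisor_sigma_def sum.reindex)
qed

lemma prime_power_Suc_add_5_eq_iff:
  fixes q k :: nat
  assumes "prime q"
  shows "q ^ Suc k + 5 = 6 * q \<longleftrightarrow> k = 1 \<and> q = 5"
proof
  assume eq: "q ^ Suc k + 5 = 6 * q"
  have "q dvd q ^ Suc k + 5"
    unfolding eq by simp
  then have "q dvd 5"
    by (subst (asm) dvd_add_right_iff) simp_all
  then have "q = 5"
    using assms by (intro primes_dvd_imp_eq) simp_all
  moreover from this eq have "(5::nat) ^ k = 5 ^ 1"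
    by simp
  then have "k = 1"
    by (subst (asm) power_inject_exp) simp_all
  ultimately show "k = 1 \<and> q = 5"
    by simp
qed simp

theorem theorem1:
  fixes N q k n :: nat
  assumes "N = q ^ k * n\<^sup>2"
    and "odd N" and "perfect N"
    and "prime q"
    and "[q = 1] (mod 4)" and "[k = 1] (mod 4)"
    and "coprime q n"
  shows "abundancy (n\<^sup>2) = 2 - 5 / (3 * real q) \<longleftrightarrow> k = 1 \<and> q = 5"
proof -
  define S where "S = real (divisor_sigma (q ^ k))"
  define P where "P = real q ^ k"
  have q: "real q > 1"
    using prime_gt_1_nat[OF \<open>prime q\<close>] by simp
  have "P > 0"
    using q by (simp add: P_def)
  have "n > 0"
    using \<open>odd N\<close> \<open>N = q ^ k * n\<^sup>2\<close> by (intro Nat.gr0I) simp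
  have "S = (\<Sum>i\<le>k. real q ^ i)"
    by (simp add: S_def divisor_sigma_prime_power[OF \<open>prime q\<close>])
  \<comment> \<open>The sum has \<open>k + 1\<close> terms, so the top power is
    \<open>q ^ Suc k\<close>, written \<open>real q * P\<close>.\<close>
  then have geo: "(real q - 1) * S = real q * P - 1"
    using power_diff_1_eq[of "real q" "Suc k"] by (simp add: P_def lessThan_Suc_atMost)
  have "real q * P > 1"
    using q one_less_power[of "real q" "Suc k"] by (simp add: P_def)
  then have "S > 0"
    using geo q by (metis diff_gt_0_iff_gt zero_less_mult_pos)
  have "divisor_sigma (q ^ k) * divisor_sigma (n\<^sup>2) = 2 * (q ^ k * n\<^sup>2)"
    using assms by (simp add: perfect_def flip: divisor_sigma_mult_coprime)
  then have "real (divisor_sigma (q ^ k) * divisor_sigma (n\<^sup>2)) = real (2 * (q ^ k * n\<^sup>2))"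
    by (rule arg_cong)
  then have "S * abundancy (n\<^sup>2) = 2 * P"
    using \<open>n > 0\<close> by (simp add: S_def P_def abundancy_def field_simps)
  then have I: "abundancy (n\<^sup>2) = 2 * P / S"
    using \<open>S > 0\<close> by (simp add: field_simps)
  have "abundancy (n\<^sup>2) = 2 - 5 / (3 * real q) \<longleftrightarrow> 6 * real q * P = (6 * real q - 5) * S"
    unfolding I using q \<open>S > 0\<close> by (simp add: field_simps)
  \<comment> \<open>The nonzero factor \<open>real q - 1\<close> is inserted so that
    \<open>geo\<close> can eliminate \<open>S\<close>.\<close>
  also have "\<dots> \<longleftrightarrow> (real q - 1) * (6 * real q * P) = (real q - 1) * ((6 * real q - 5) * S)"
    using q by simp
  also have "(real q - 1) * ((6 * real q - 5) * S) = (6 * real q - 5) * (real q * P - 1)"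
    by (simp flip: geo)
  \<comment> \<open>After expansion the terms in \<open>q\<^sup>2 * P\<close> cancel, and
    \<open>-6 * q * P\<close> against \<open>-5 * q * P\<close> leaves a single
    \<open>q * P\<close>.\<close>
  also have "(real q - 1) * (6 * real q * P) = (6 * real q - 5) * (real q * P - 1)
      \<longleftrightarrow> real q * P + 5 = 6 * real q"
    by (auto simp: algebra_simps)
  \<comment> \<open>Back to natural numbers, where divisibility by \<open>q\<close> can be
    used.\<close>
  also have "\<dots> \<longleftrightarrow> real (q ^ Suc k + 5) = real (6 * q)"
    by (simp add: P_def)
  also have "\<dots> \<longleftrightarrow> k = 1 \<and> q = 5"
    by (simp only: of_nat_eq_iff prime_power_Suc_add_5_eq_iff[OF \<open>prime q\<close>])
  finally show ?thesis .
qed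

end
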